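(* Let $z=(z_1,z_2,z_3)\in\mathbb R^3$, $z\ne0$. There are infinitely many geodesics $c:[0,1]\to Q^n$ joining the origin with the point $(0,z)$. For each multi-index $\mathbf n=(n_1,\dots,n_n)$ of positive integers, the equations of the geodesics $c=(x^{(\mathbf n)},z^{(\mathbf n)})$ corresponding to $\mathbf n$, with initial velocity $\dot x(0)=(\dot x_1(0),\dots,\dot x_n(0))$, are $$x^{(\mathbf n)}_l(s)=2\,\frac{1-\cos(2s\pi n_l)}{(\pi n_l)^2}[\mathbf Z]_l\dot x_l(0)+\frac{\sin(2s\pi n_l)}{2\pi n_l}\dot x_l(0),\qquad l=1,\dots,n,$$ $$z^{(\mathbf n)}_m(s)=\frac{z_m}{D_m}\sum_{l=1}^n\frac{a_{ml}^2|\dot x_l(0)|^2}{(\pi n_l)^2}\Big(s-\frac{\sin(2s\pi n_l)}{2\pi n_l}\Big),\qquad m=1,2,3,$$ where $D_m=\sum_{l=1}^n\frac{a_{ml}^2|\dot x_l(0)|^2}{(\pi n_l)^2}$ and $$[\mathbf Z]_l=\frac{z_1a_{1l}}{D_1}\mathcal M_1+\frac{z_2a_{2l}}{D_2}\mathcal M_2+\frac{z_3a_{3l}}{D_3}\mathcal M_3 .$$ The lengths $l_{\mathbf n}$ of the corresponding geodesics satisfy $$l_{\mathbf n}^2=16\sum_{m=1}^3\frac{z_m^2}{D_m}.$$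
   Context: Fix $n\ge 1$ and real constants $a_{ml}>0$ ($m=1,2,3$, $l=1,\dots,n$). Let $$\mathcal M_1=\begin{pmatrix}0&1&0&0\\-1&0&0&0\\0&0&0&1\\0&0&-1&0\end{pmatrix},\quad \mathcal M_2=\begin{pmatrix}0&0&0&-1\\0&0&-1&0\\0&1&0&0\\1&0&0&0\end{pmatrix},\quad \mathcal M_3=\begin{pmatrix}0&0&-1&0\\0&0&0&1\\1&0&0&0\\0&-1&0&0\end{pmatrix},$$ and let $\mathbf M_m$ be the $4n\times 4n$ block diagonal matrix with diagonal blocks $a_{m1}\mathcal M_m,\dots,a_{mn}\mathcal M_m$. The anisotropic quaternion group $Q^n$ is $\mathbb R^{4n}\times\mathbb R^3$ with points $(x,z)$, $x=(x_1,\dots,x_n)$, $x_l\in\mathbb R^4$, $z=(z_1,z_2,z_3)$, and the group law $(x,z)\circ(x',z')=\big(x+x',\,(z_m+z_m'+\tfrac12(\mathbf M_m x,x'))_{m=1,2,3}\big)$. Hamiltonian: for $\xi\in\mathbb R^{4n}$, $\theta\in\mathbb R^3$, $$H(\xi,\theta,x,z)=|\xi|^2+\tfrac14\sum_{m=1}^3\Big(\sum_{l=1}^n a_{ml}^2|x_l|^2\Big)\theta_m^2+\Big(\sum_{m=1}^3\theta_m\mathbf M_m x,\xi\Big).$$ A bicharacteristic is a solution $(x(s),z(s),\xi(s),\theta(s))$ of $\dot x=\partial H/\partial\xi$, $\dot z_m=\partial H/\partial\theta_m$, $\dot\xi=-\partial H/\partial x$, $\dot\theta_m=-\partial H/\partial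 z_m=0$ (so $\theta$ is constant). A geodesic from $P_1$ to $P_2$ is the projection to the $(x,z)$-space of a bicharacteristic, starting at $P_1$ and ending at $P_2$. Its length is $\int_0^1|\dot x(s)|\,ds$. Write $|\theta|_l=\big(\sum_{m=1}^3a_{ml}^2\theta_m^2\big)^{1/2}$. A geodesic joining the origin with $(0,z)$ corresponds to the multi-index $\mathbf n$ if its bicharacteristic has $|\theta|_l=\pi n_l$ for every $l$ with $\dot x_l(0)\neq0$. *)

theory Defs
  imports "HOL-Analysis.Analysis"
begin

text \<open>
  A point \<open>x = (x\<^sub>1, \<dots>, x\<^sub>n)\<close> of \<open>\<real>\<^sup>4\<^sup>n\<close>, with \<open>x\<^sub>l \<in> \<real>\<^sup>4\<close>, is an element of \<^typ>\<open>real^4^'n\<close>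
  with \<open>x\<^sub>l = x $ l\<close> and \<open>n = CARD('n) \<ge> 1\<close>; the inner product and norm of this type are the
  Euclidean ones of \<open>\<real>\<^sup>4\<^sup>n\<close>. The constants \<open>a\<^sub>m\<^sub>l\<close> are \<open>a m l\<close>; in the index type \<^typ>\<open>3\<close> the
  elements are \<open>1\<close>, \<open>2\<close> and \<open>3\<close> (\<open>= 0\<close>).
\<close>

definition quatM :: "3 \<Rightarrow> real^4^4" where
  "quatM m =
    (if m = 1 then
       vector [vector [ 0,  1,  0,  0],
               vector [-1,  0,  0,  0],
               vector [ 0,  0,  0,  1],
               vector [ 0,  0, -1,  0]]
     else if m = 2 then
       vector [vector [ 0,  0,  0, -1],
               vector [ 0,  0, -1,  0],
               vector [ 0,  1,  0,  0],
               vector [ 1,  0,  0,  0]]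
     else
       vector [vector [ 0,  0, -1,  0],
               vector [ 0,  0,  0,  1],
               vector [ 1,  0,  0,  0],
               vector [ 0, -1,  0,  0]])"

text \<open>The block diagonal matrix with diagonal blocks \<open>a\<^sub>m\<^sub>l \<M>\<^sub>m\<close>, as a linear map acting block by block.\<close>

definition blockM :: "(3 \<Rightarrow> 'n::finite \<Rightarrow> real) \<Rightarrow> 3 \<Rightarrow> real^4^'n \<Rightarrow> real^4^'n" where
  "blockM a m x = (\<chi> l. (a m l *\<^sub>R quatM m) *v (x $ l))"

type_synonym 'n quat_point = "(real^4^'n) \<times> (real^3)"

text \<open>
  The group law of \<open>Q\<^sup>n\<close>. Geodesics are defined through the Hamiltonian below, so that they
  depend on it only through the matrices \<^const>\<open>blockM\<close>.
\<close>

definition quat_mult ::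
    "(3 \<Rightarrow> 'n::finite \<Rightarrow> real) \<Rightarrow> 'n quat_point \<Rightarrow> 'n quat_point \<Rightarrow> 'n quat_point" where
  "quat_mult a p q =
     (fst p + fst q, \<chi> m. snd p $ m + snd q $ m + 1/2 * (blockM a m (fst p) \<bullet> fst q))"

definition Ham ::
    "(3 \<Rightarrow> 'n::finite \<Rightarrow> real) \<Rightarrow> real^4^'n \<Rightarrow> real^3 \<Rightarrow> real^4^'n \<Rightarrow> real^3 \<Rightarrow> real" where
  "Ham a \<xi> \<theta> x z =
     (norm \<xi>)^2
     + 1/4 * (\<Sum>m\<in>UNIV. (\<Sum>l\<in>UNIV. (a m l)^2 * (norm (x $ l))^2) * (\<theta> $ m)^2)
     + (\<Sum>m\<in>UNIV. (\<theta> $ m) *\<^sub>R blockM a m x) \<bullet> \<xi>"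

definition gradient :: "('a::real_inner \<Rightarrow> real) \<Rightarrow> 'a \<Rightarrow> 'a" where
  "gradient f x = (THE D. GDERIV f x :> D)"

lemma gradient_eqI:
  assumes "GDERIV f x :> D"
  shows "gradient f x = D"
  unfolding gradient_def
proof (rule the_equality)
  show "GDERIV f x :> D" by fact
next
  fix E assume "GDERIV f x :> E"
  with assms have "(\<lambda>h. inner h E) = (\<lambda>h. inner h D)"
    unfolding gderiv_def by (blast intro: has_derivative_unique)
  then have "inner h (E - D) = 0" for h
    by (metis inner_diff_right right_minus_eq)
  then show "E = D"
    by (metis inner_eq_zero_iff right_minus_eq)
qed

text \<open>Derivatives at the end points of \<open>[0,1]\<close> are one-sided.\<close>

definition bicharacteristic ::
    "(3 \<Rightarrow> 'n::finite \<Rightarrow> real) \<Rightarrow> (real \<Rightarrow> real^4^'n) \<Rightarrow> (real \<Rightarrow> real^3)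
       \<Rightarrow> (real \<Rightarrow> real^4^'n) \<Rightarrow> (real \<Rightarrow> real^3) \<Rightarrow> bool" where
  "bicharacteristic a x z \<xi> \<theta> \<longleftrightarrow>
     (\<forall>s\<in>{0..1}.
        (x has_vector_derivative gradient (\<lambda>u. Ham a u (\<theta> s) (x s) (z s)) (\<xi> s))
          (at s within {0..1}) \<and>
        (z has_vector_derivative gradient (\<lambda>u. Ham a (\<xi> s) u (x s) (z s)) (\<theta> s))
          (at s within {0..1}) \<and>
        (\<xi> has_vector_derivative - gradient (\<lambda>u. Ham a (\<xi> s) (\<theta> s) u (z s)) (x s))
          (at s within {0..1}) \<and>
        (\<theta> has_vector_derivative - gradient (\<lambda>u. Ham a (\<xi> s) (\<theta> s) (x s) u) (z s))
          (at s within {0..1}))"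

text \<open>A curve \<open>c : [0,1] \<rightarrow> Q\<^sup>n\<close> is a function on \<open>\<real>\<close> of which only the values on \<open>[0,1]\<close> matter.\<close>

definition lifts_to ::
    "(3 \<Rightarrow> 'n::finite \<Rightarrow> real) \<Rightarrow> (real \<Rightarrow> 'n quat_point)
       \<Rightarrow> (real \<Rightarrow> real^4^'n) \<Rightarrow> (real \<Rightarrow> real^3) \<Rightarrow> bool" where
  "lifts_to a c \<xi> \<theta> \<longleftrightarrow> bicharacteristic a (\<lambda>s. fst (c s)) (\<lambda>s. snd (c s)) \<xi> \<theta>"

definition geodesic ::
    "(3 \<Rightarrow> 'n::finite \<Rightarrow> real) \<Rightarrow> 'n quat_point \<Rightarrow> 'n quat_point
       \<Rightarrow> (real \<Rightarrow> 'n quat_point) \<Rightarrow> bool" where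
  "geodesic a P1 P2 c \<longleftrightarrow> (\<exists>\<xi> \<theta>. lifts_to a c \<xi> \<theta>) \<and> c 0 = P1 \<and> c 1 = P2"

definition velocity :: "(real \<Rightarrow> 'n::finite quat_point) \<Rightarrow> real \<Rightarrow> real^4^'n" where
  "velocity c s = vector_derivative (\<lambda>t. fst (c t)) (at s within {0..1})"

definition geodesic_length :: "(real \<Rightarrow> 'n::finite quat_point) \<Rightarrow> real" where
  "geodesic_length c = integral {0..1} (\<lambda>s. norm (velocity c s))"

definition theta_abs :: "(3 \<Rightarrow> 'n::finite \<Rightarrow> real) \<Rightarrow> real^3 \<Rightarrow> 'n \<Rightarrow> real" where
  "theta_abs a \<theta> l = sqrt (\<Sum>m\<in>UNIV. (a m l)^2 * (\<theta> $ m)^2)"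

definition corresponds_to ::
    "(3 \<Rightarrow> 'n::finite \<Rightarrow> real) \<Rightarrow> (real \<Rightarrow> 'n quat_point) \<Rightarrow> ('n \<Rightarrow> nat) \<Rightarrow> bool" where
  "corresponds_to a c n \<longleftrightarrow>
     (\<exists>\<xi> \<theta>. lifts_to a c \<xi> \<theta> \<and>
        (\<forall>l. velocity c 0 $ l \<noteq> 0 \<longrightarrow> (\<forall>s\<in>{0..1}. theta_abs a (\<theta> s) l = pi * real (n l))))"

definition Dcoef ::
    "(3 \<Rightarrow> 'n::finite \<Rightarrow> real) \<Rightarrow> ('n \<Rightarrow> nat) \<Rightarrow> real^4^'n \<Rightarrow> 3 \<Rightarrow> real" where
  "Dcoef a n v m = (\<Sum>l\<in>UNIV. (a m l)^2 * (norm (v $ l))^2 / (pi * real (n l))^2)"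

definition Zmat ::
    "(3 \<Rightarrow> 'n::finite \<Rightarrow> real) \<Rightarrow> ('n \<Rightarrow> nat) \<Rightarrow> real^3 \<Rightarrow> real^4^'n \<Rightarrow> 'n \<Rightarrow> real^4^4" where
  "Zmat a n z v l = (\<Sum>m\<in>UNIV. (z $ m * a m l / Dcoef a n v m) *\<^sub>R quatM m)"

end

theory Submission
  imports Defs
begin

text \<open>
  Put \<open>\<Omega> = \<Sum>\<^sub>m \<theta>\<^sub>m \<^bold>M\<^sub>m\<close>. The Hamiltonian is the perfect square \<open>H = |\<xi> + \<Omega> x / 2|\<^sup>2\<close>,
  because the \<open>\<M>\<^sub>m\<close> are anticommuting complex structures (\<open>imag_quat_inner\<close>, \<open>Ham_eq_square\<close>).
  With \<open>u = 2\<xi> + \<Omega> x\<close>, Hamilton's equations therefore read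
  \<open>x' = u\<close>, \<open>z\<^sub>m' = (\<^bold>M\<^sub>m x, u) / 2\<close>, \<open>\<xi>' = \<Omega> u / 2\<close>, \<open>\<theta>' = 0\<close>, so that \<open>\<theta>\<close> is constant and the
  velocity solves the linear equation \<open>u' = 2\<Omega> u\<close>. Conversely every solution of the equations
  for \<open>x\<close>, \<open>z\<close>, \<open>u\<close> comes from a bicharacteristic (\<open>bicharacteristic_imp_rotation\<close>,
  \<open>rotation_imp_bicharacteristic\<close>).

  As \<open>\<Omega>\<close> is skew, \<open>|u|\<close> is conserved and the length of the geodesic is \<open>|u(0)|\<close>. On the block \<open>l\<close>
  one has \<open>\<Omega>\<^sup>2 = -|\<theta>|\<^sub>l\<^sup>2\<close>, so \<open>u\<^sub>l\<close> rotates with angular frequency \<open>2|\<theta>|\<^sub>l\<close>. Integrating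
  once gives \<open>x\<^sub>l\<close>, and integrating the area swept by \<open>x\<^sub>l\<close> gives \<open>z\<close> (\<open>rotation_from_origin\<close>). If
  \<open>|\<theta>|\<^sub>l = \<pi> n\<^sub>l\<close> on the moving blocks, evaluation at \<open>s = 1\<close> gives \<open>z\<^sub>m = \<theta>\<^sub>m D\<^sub>m / 4\<close>. Hence
  \<open>z \<noteq> 0\<close> forces some block to move, all \<open>D\<^sub>m\<close> are positive, \<open>\<theta>\<^sub>m = 4 z\<^sub>m / D\<^sub>m\<close> can be eliminated,
  and \<open>|u(0)|\<^sup>2 = \<Sum>\<^sub>m \<theta>\<^sub>m\<^sup>2 D\<^sub>m\<close> (\<open>corresponding_geodesic\<close>).

  There are infinitely many geodesics because already those that move in a single block reach
  \<open>(0, z)\<close> after any number \<open>k \<ge> 1\<close> of full turns, with squared length proportional to \<open>k\<close>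
  (\<open>single_block_geodesic\<close>).
\<close>

section \<open>Quaternionic structure of the matrices\<close>

definition imag_quat :: "(3 \<Rightarrow> real) \<Rightarrow> real^4^4" where
  "imag_quat c = (\<Sum>m\<in>UNIV. c m *\<^sub>R quatM m)"

lemma vector_4:
  "(vector [w, x, y, z] :: 'a::zero^4)$1 = w" "(vector [w, x, y, z] :: 'a^4)$2 = x"
  "(vector [w, x, y, z] :: 'a^4)$3 = y" "(vector [w, x, y, z] :: 'a^4)$4 = z"
  unfolding vector_def by simp_all

lemma imag_quat_mult:
  "imag_quat c *v u =
     vector [c 1 * u$2 - c 2 * u$4 - c 3 * u$3, - c 1 * u$1 - c 2 * u$3 + c 3 * u$4,
       c 1 * u$4 + c 2 * u$2 + c 3 * u$1, - c 1 * u$3 + c 2 * u$1 - c 3 * u$2]"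
  by (simp add: imag_quat_def quatM_def vector_4 vec_eq_iff forall_4 matrix_vector_mult_def sum_3 sum_4
      algebra_simps)

lemma quatM_eq_imag_quat: "quatM m = imag_quat (\<lambda>k. if k = m then 1 else 0)"
  by (simp add: imag_quat_def if_distrib[of "\<lambda>c. c *\<^sub>R _"] cong: if_cong)

lemma imag_quat_skew: "(imag_quat c *v u) \<bullet> v = - (u \<bullet> (imag_quat c *v v))"
  by (simp add: imag_quat_mult vector_4 inner_vec_def sum_4 algebra_simps)

text \<open>
  For fixed \<open>u \<noteq> 0\<close> the three vectors \<open>\<M>\<^sub>m u\<close> are orthogonal and of length \<open>|u|\<close>, which is the
  anticommutation of the \<open>\<M>\<^sub>m\<close> in disguise.
\<close>

lemma imag_quat_inner:
  "(imag_quat c *v u) \<bullet> (imag_quat d *v u) = (\<Sum>m\<in>UNIV. c m * d m) * (u \<bullet> u)"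
  by (simp add: imag_quat_mult vector_4 inner_vec_def sum_4 sum_3 algebra_simps)

text \<open>
  The square of an imaginary quaternion is minus its squared modulus. This is what turns the
  equation of motion on each block into a rotation at one frequency.
\<close>

lemma imag_quat_square:
  "imag_quat c *v (imag_quat c *v u) = - (\<Sum>m\<in>UNIV. (c m)\<^sup>2) *\<^sub>R u"
  by (simp add: imag_quat_mult vector_4 vec_eq_iff forall_4 sum_3 algebra_simps power2_eq_square)
section \<open>The Hamiltonian as a square\<close>

text \<open>
  The matrix \<open>\<Sum>\<^sub>m \<theta>\<^sub>m \<^bold>M\<^sub>m\<close> of the third term of the Hamiltonian, written \<open>\<Omega>\<close> below. On the
  block \<open>l\<close> it is the imaginary quaternion with coefficients \<open>a\<^sub>m\<^sub>l \<theta>\<^sub>m\<close>.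
\<close>

definition drift :: "(3 \<Rightarrow> 'n::finite \<Rightarrow> real) \<Rightarrow> real^3 \<Rightarrow> real^4^'n \<Rightarrow> real^4^'n" where
  "drift a \<theta> x = (\<Sum>m\<in>UNIV. \<theta> $ m *\<^sub>R blockM a m x)"

lemma inner_blocks: "(x :: real^4^'n) \<bullet> y = (\<Sum>l\<in>UNIV. x $ l \<bullet> y $ l)"
  by (fact inner_vec_def)

lemma blockM_skew: "blockM a m x \<bullet> y = - (x \<bullet> blockM a m y)"
  by (simp add: inner_blocks blockM_def scaleR_matrix_vector_assoc[symmetric]
      quatM_eq_imag_quat imag_quat_skew sum_negf)

lemma bounded_linear_blockM: "bounded_linear (blockM a m)"
  by (auto simp: linear_conv_bounded_linear[symmetric] blockM_def vec_eq_iff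
      matrix_vector_right_distrib matrix_vector_mult_scaleR intro!: linearI)

lemma bounded_linear_drift: "bounded_linear (drift a \<theta>)"
  unfolding drift_def
  by (intro bounded_linear_sum bounded_linear_const_scaleR bounded_linear_blockM)

lemma bounded_linear_drift_left: "bounded_linear (\<lambda>\<theta>. drift a \<theta> x)"
  unfolding drift_def
  by (intro bounded_linear_sum bounded_linear_scaleR_const bounded_linear_vec_nth)

lemma drift_nth: "drift a \<theta> x $ l = imag_quat (\<lambda>m. a m l * \<theta> $ m) *v (x $ l)"
  by (simp add: drift_def imag_quat_def blockM_def sum_3 matrix_vector_mult_add_rdistrib
      scaleR_matrix_vector_assoc[symmetric] mult.commute)

lemma drift_skew: "drift a \<theta> x \<bullet> y = - (x \<bullet> drift a \<theta> y)"
  by (simp add: inner_blocks drift_nth imag_quat_skew sum_negf)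

lemma theta_abs_square: "(theta_abs a \<theta> l)\<^sup>2 = (\<Sum>m\<in>UNIV. (a m l * \<theta> $ m)\<^sup>2)"
  by (simp add: theta_abs_def sum_nonneg power_mult_distrib)

text \<open>
  The quartic term of the Hamiltonian is \<open>|\<Omega> x|\<^sup>2 / 4\<close>, because the mixed terms
  \<open>\<theta>\<^sub>m \<theta>\<^sub>k (\<^bold>M\<^sub>m x, \<^bold>M\<^sub>k x)\<close> with \<open>m \<noteq> k\<close> vanish. It completes the square.
\<close>

lemma Ham_eq_square: "Ham a \<xi> \<theta> x z = (norm (\<xi> + (1/2) *\<^sub>R drift a \<theta> x))\<^sup>2"
proof -
  have "drift a \<theta> x \<bullet> drift a \<theta> x
      = (\<Sum>l\<in>UNIV. \<Sum>m\<in>UNIV. (a m l)\<^sup>2 * (\<theta> $ m)\<^sup>2 * (norm (x $ l))\<^sup>2)"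
    by (simp add: inner_blocks drift_nth imag_quat_inner sum_distrib_right power2_norm_eq_inner)
       (simp add: power2_eq_square mult_ac)
  also have "\<dots> = (\<Sum>m\<in>UNIV. (\<Sum>l\<in>UNIV. (a m l)\<^sup>2 * (norm (x $ l))\<^sup>2) * (\<theta> $ m)\<^sup>2)"
    by (subst sum.swap) (simp add: sum_distrib_left mult_ac)
  finally show ?thesis
    unfolding Ham_def drift_def[symmetric] power2_norm_eq_inner
    by (simp add: inner_add_left inner_add_right inner_commute)
qed

lemma gradient_norm_square:
  assumes f: "(f has_derivative f') (at x)" and adj: "\<And>h. f' h \<bullet> (2 *\<^sub>R f x) = h \<bullet> D"
  shows "gradient (\<lambda>u. (norm (f u))\<^sup>2) x = D"
proof (rule gradient_eqI)
  have "((\<lambda>u. f u \<bullet> f u) has_derivative (\<lambda>h. f x \<bullet> f' h + f' h \<bullet> f x)) (at x)"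
    by (intro has_derivative_inner f)
  also have "(\<lambda>h. f x \<bullet> f' h + f' h \<bullet> f x) = (\<lambda>h. h \<bullet> D)"
    using adj by (simp add: inner_commute fun_eq_iff)
  finally show "GDERIV (\<lambda>u. (norm (f u))\<^sup>2) x :> D"
    by (simp add: gderiv_def power2_norm_eq_inner)
qed

text \<open>
  Each gradient of \<open>|\<xi> + \<Omega> x / 2|\<^sup>2\<close> represents the pairing of the inner derivative with
  \<open>2(\<xi> + \<Omega> x / 2) = u\<close>; skewness of \<open>\<Omega>\<close> moves it onto \<open>u\<close> in the gradient by \<open>x\<close>.
\<close>

lemma Ham_gradients:
  fixes a :: "3 \<Rightarrow> 'n::finite \<Rightarrow> real" and \<xi> x :: "real^4^'n" and \<theta> :: "real^3"
  defines "u \<equiv> 2 *\<^sub>R \<xi> + drift a \<theta> x"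
  shows "gradient (\<lambda>\<xi>. Ham a \<xi> \<theta> x z) \<xi> = u"
    and "gradient (\<lambda>\<theta>. Ham a \<xi> \<theta> x z) \<theta> = (\<chi> m. 1/2 * (blockM a m x \<bullet> u))"
    and "gradient (\<lambda>x. Ham a \<xi> \<theta> x z) x = - (1/2) *\<^sub>R drift a \<theta> u"
    and "gradient (\<lambda>z. Ham a \<xi> \<theta> x z) z = 0"
proof -
  note drift_deriv = bounded_linear.has_derivative[OF bounded_linear_drift]
    bounded_linear.has_derivative[OF bounded_linear_drift_left]
  have u: "2 *\<^sub>R (\<xi> + (1/2) *\<^sub>R drift a \<theta> x) = u"
    by (simp add: u_def scaleR_add_right)
  show "gradient (\<lambda>\<xi>. Ham a \<xi> \<theta> x z) \<xi> = u"
    unfolding Ham_eq_square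
    by (rule gradient_norm_square[where f' = "\<lambda>h. h"])
       (auto simp: u intro!: derivative_eq_intros)
  show "gradient (\<lambda>\<theta>. Ham a \<xi> \<theta> x z) \<theta> = (\<chi> m. 1/2 * (blockM a m x \<bullet> u))"
    unfolding Ham_eq_square
  proof (rule gradient_norm_square[where f' = "\<lambda>h. (1/2) *\<^sub>R drift a h x"], unfold u)
    show "(1/2) *\<^sub>R drift a h x \<bullet> u = h \<bullet> (\<chi> m. 1/2 * (blockM a m x \<bullet> u))" for h
      by (simp add: drift_def inner_vec_def[of h] inner_sum_left sum_distrib_left mult_ac)
  qed (auto intro!: derivative_eq_intros drift_deriv)
  show "gradient (\<lambda>x. Ham a \<xi> \<theta> x z) x = - (1/2) *\<^sub>R drift a \<theta> u"
    unfolding Ham_eq_square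
  proof (rule gradient_norm_square[where f' = "\<lambda>h. (1/2) *\<^sub>R drift a \<theta> h"], unfold u)
    show "(1/2) *\<^sub>R drift a \<theta> h \<bullet> u = h \<bullet> (- (1/2) *\<^sub>R drift a \<theta> u)" for h
      by (simp add: drift_skew[of a \<theta> h])
  qed (auto intro!: derivative_eq_intros drift_deriv)
  show "gradient (\<lambda>z. Ham a \<xi> \<theta> x z) z = 0"
    unfolding Ham_eq_square by (rule gradient_eqI) (rule GDERIV_const)
qed

lemma bicharacteristic_iff:
  "bicharacteristic a x z \<xi> \<theta> \<longleftrightarrow>
     (\<forall>s\<in>{0..1}. let u = 2 *\<^sub>R \<xi> s + drift a (\<theta> s) (x s) in
        (x has_vector_derivative u) (at s within {0..1}) \<and>
        (z has_vector_derivative (\<chi> m. 1/2 * (blockM a m (x s) \<bullet> u))) (at s within {0..1}) \<and>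
        (\<xi> has_vector_derivative (1/2) *\<^sub>R drift a (\<theta> s) u) (at s within {0..1}) \<and>
        (\<theta> has_vector_derivative 0) (at s within {0..1}))"
  by (simp add: bicharacteristic_def Ham_gradients Let_def)

section \<open>Flows of skew linear maps\<close>

lemma vector_derivative_zero_imp_constant:
  fixes f :: "real \<Rightarrow> 'a::real_normed_vector"
  assumes "\<And>s. s \<in> {0..1} \<Longrightarrow> (f has_vector_derivative 0) (at s within {0..1})" and "s \<in> {0..1}"
  shows "f s = f 0"
  using has_vector_derivative_zero_constant[of "{0..1::real}" f] assms
  by (metis atLeastAtMost_iff convex_real_interval(5) order_refl zero_le_one)

text \<open>
  Conservation of energy. Applied to \<open>u\<close> it computes the length; applied to the difference of two
  solutions it gives uniqueness for the linear equation of motion.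
\<close>

lemma skew_flow_norm_constant:
  fixes u :: "real \<Rightarrow> 'a::real_inner"
  assumes u: "\<And>s. s \<in> {0..1} \<Longrightarrow> (u has_vector_derivative k *\<^sub>R A (u s)) (at s within {0..1})"
    and skew: "\<And>y. y \<bullet> A y = 0" and "s \<in> {0..1}"
  shows "norm (u s) = norm (u 0)"
proof -
  have "((\<lambda>s. u s \<bullet> u s) has_vector_derivative 0) (at t within {0..1})" if "t \<in> {0..1}" for t
    using has_derivative_inner[OF u[OF that, unfolded has_vector_derivative_def]
        u[OF that, unfolded has_vector_derivative_def]]
    by (simp add: has_vector_derivative_def skew inner_commute[of "A _"])
  then have "u s \<bullet> u s = u 0 \<bullet> u 0"
    using vector_derivative_zero_imp_constant[of "\<lambda>s. u s \<bullet> u s"] assms(3) by blast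
  then show ?thesis by (simp add: norm_eq_sqrt_inner)
qed

text \<open>
  When \<open>A\<^sup>2 v = -w\<^sup>2 v\<close>, the orbit of \<open>v\<close> under \<open>exp (2sA)\<close> is a rotation with frequency \<open>2w\<close> in the
  plane of \<open>v\<close> and \<open>A v\<close>. The relation is only asked of the one vector \<open>v\<close>, so that the lemma covers
  a vector of \<open>\<real>\<^sup>4\<^sup>n\<close> supported in one block, although \<open>\<Omega>\<^sup>2\<close> differs from block to block, and
  also \<open>v = 0\<close> with an arbitrary \<open>w \<noteq> 0\<close>.
\<close>

lemma rotation_flow_derivative:
  assumes A: "bounded_linear A" "A (A v) = - (w\<^sup>2) *\<^sub>R v" and "w \<noteq> 0"
  shows "((\<lambda>s. cos (2 * w * s) *\<^sub>R v + (sin (2 * w * s) / w) *\<^sub>R A v) has_vector_derivative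
      2 *\<^sub>R A (cos (2 * w * s) *\<^sub>R v + (sin (2 * w * s) / w) *\<^sub>R A v)) (at s within S)"
proof -
  interpret bounded_linear A by fact
  have c: "((\<lambda>s. cos (2 * w * s)) has_real_derivative - 2 * w * sin (2 * w * s)) (at s within S)"
    and d: "((\<lambda>s. sin (2 * w * s) / w) has_real_derivative 2 * cos (2 * w * s)) (at s within S)"
    using \<open>w \<noteq> 0\<close>
    by (auto intro!: derivative_eq_intros)
  show ?thesis
    by (rule has_vector_derivative_eq_rhs[OF has_vector_derivative_add[OF
        has_vector_derivative_scaleR[OF c has_vector_derivative_const]
        has_vector_derivative_scaleR[OF d has_vector_derivative_const]]])
       (simp add: scaleR add A power2_eq_square \<open>w \<noteq> 0\<close> scaleR_diff_right mult_ac)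
qed

lemma rotation_flow_integral:
  fixes v :: "'a::real_normed_vector"
  assumes "w \<noteq> 0"
  shows "((\<lambda>s. (sin (2 * w * s) / (2 * w)) *\<^sub>R v + ((1 - cos (2 * w * s)) / (2 * w\<^sup>2)) *\<^sub>R v')
      has_vector_derivative cos (2 * w * s) *\<^sub>R v + (sin (2 * w * s) / w) *\<^sub>R v') (at s within S)"
proof -
  have c: "((\<lambda>s. sin (2 * w * s) / (2 * w)) has_real_derivative cos (2 * w * s)) (at s within S)"
    and d: "((\<lambda>s. (1 - cos (2 * w * s)) / (2 * w\<^sup>2)) has_real_derivative sin (2 * w * s) / w)
      (at s within S)"
    using assms
    by (auto intro!: derivative_eq_intros simp: power2_eq_square)
  show ?thesis
    by (rule has_vector_derivative_eq_rhs[OF has_vector_derivative_add[OF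
        has_vector_derivative_scaleR[OF c has_vector_derivative_const]
        has_vector_derivative_scaleR[OF d has_vector_derivative_const]]]) simp
qed

text \<open>
  Here \<open>v'\<close> stands for \<open>A v\<close>. A skew form is alternating, so only the determinant of the coefficients
  of position and velocity survives, and \<open>sin\<^sup>2 + cos\<^sup>2 = 1\<close> reduces it to one cosine.
\<close>

lemma rotation_flow_area:
  fixes v :: "'a::real_inner"
  assumes B: "bounded_linear B" "\<And>x y. B x \<bullet> y = - (x \<bullet> B y)" and "w \<noteq> 0"
  shows "B ((sin (2 * w * s) / (2 * w)) *\<^sub>R v + ((1 - cos (2 * w * s)) / (2 * w\<^sup>2)) *\<^sub>R v')
      \<bullet> (cos (2 * w * s) *\<^sub>R v + (sin (2 * w * s) / w) *\<^sub>R v')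
    = (1 - cos (2 * w * s)) / (2 * w\<^sup>2) * (B v \<bullet> v')"
proof -
  interpret bounded_linear B by fact
  have "B y \<bullet> y = 0" for y using B(2)[of y y] by (simp add: inner_commute)
  moreover have "B v' \<bullet> v = - (B v \<bullet> v')" using B(2)[of v' v] by (simp add: inner_commute)
  ultimately have "B (p *\<^sub>R v + q *\<^sub>R v') \<bullet> (p' *\<^sub>R v + q' *\<^sub>R v') = (p * q' - q * p') * (B v \<bullet> v')"
    for p q p' q' by (simp add: scaleR add inner_add_left inner_add_right algebra_simps)
  moreover have "sin (2 * w * s) / (2 * w) * (sin (2 * w * s) / w)
      - (1 - cos (2 * w * s)) / (2 * w\<^sup>2) * cos (2 * w * s) = (1 - cos (2 * w * s)) / (2 * w\<^sup>2)"
    using sin_cos_squared_add[of "2 * w * s"] \<open>w \<noteq> 0\<close>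
    by (simp add: field_simps power2_eq_square)
  ultimately show ?thesis by simp
qed

section \<open>Bicharacteristics as rotating velocities\<close>

text \<open>
  Differentiating \<open>u = 2\<xi> + \<Omega> x\<close> gives \<open>\<Omega> u\<close> from each of the two terms, hence \<open>u' = 2\<Omega> u\<close>: the
  covector \<open>\<xi>\<close> disappears from the equations.
\<close>

lemma bicharacteristic_imp_rotation:
  assumes "bicharacteristic a x z \<xi> \<theta>"
  obtains \<theta>\<^sub>0 u where "\<And>s. s \<in> {0..1} \<Longrightarrow> \<theta> s = \<theta>\<^sub>0"
    and "\<And>s. s \<in> {0..1} \<Longrightarrow> (x has_vector_derivative u s) (at s within {0..1})"
    and "\<And>s. s \<in> {0..1} \<Longrightarrow> (u has_vector_derivative 2 *\<^sub>R drift a \<theta>\<^sub>0 (u s)) (at s within {0..1})"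
    and "\<And>s. s \<in> {0..1} \<Longrightarrow>
      (z has_vector_derivative (\<chi> m. 1/2 * (blockM a m (x s) \<bullet> u s))) (at s within {0..1})"
proof -
  have "\<theta> s = \<theta> 0" if "s \<in> {0..1}" for s
    using assms that by (intro vector_derivative_zero_imp_constant)
      (auto simp: bicharacteristic_iff Let_def)
  note \<theta> = this
  define u where "u = (\<lambda>s. 2 *\<^sub>R \<xi> s + drift a (\<theta> 0) (x s))"
  have x: "(x has_vector_derivative u s) (at s within {0..1})"
    and z: "(z has_vector_derivative (\<chi> m. 1/2 * (blockM a m (x s) \<bullet> u s))) (at s within {0..1})"
    and \<xi>: "(\<xi> has_vector_derivative (1/2) *\<^sub>R drift a (\<theta> 0) (u s)) (at s within {0..1})"
    if "s \<in> {0..1}" for s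
    using bspec[OF assms[unfolded bicharacteristic_iff] that] \<theta>[OF that]
    by (simp_all add: Let_def u_def)
  have "(u has_vector_derivative 2 *\<^sub>R drift a (\<theta> 0) (u s)) (at s within {0..1})"
    if s: "s \<in> {0..1}" for s
    unfolding u_def
    by (rule has_vector_derivative_eq_rhs[OF has_vector_derivative_add[OF
          bounded_linear.has_vector_derivative[OF bounded_linear_scaleR_right \<xi>[OF s]]
          bounded_linear.has_vector_derivative[OF bounded_linear_drift x[OF s]]]])
       (simp add: u_def scaleR_2)
  note u = this
  show thesis by (rule that[OF \<theta> x u z])
qed

text \<open>
  The lift is recovered by solving \<open>u = 2\<xi> + \<Omega> x\<close> for \<open>\<xi>\<close>.
\<close>

lemma rotation_imp_bicharacteristic:
  assumes x: "\<And>s. s \<in> {0..1} \<Longrightarrow> (x has_vector_derivative u s) (at s within {0..1})"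
    and u: "\<And>s. s \<in> {0..1} \<Longrightarrow> (u has_vector_derivative 2 *\<^sub>R drift a \<theta> (u s)) (at s within {0..1})"
    and z: "\<And>s. s \<in> {0..1} \<Longrightarrow>
      (z has_vector_derivative (\<chi> m. 1/2 * (blockM a m (x s) \<bullet> u s))) (at s within {0..1})"
  shows "bicharacteristic a x z (\<lambda>s. (1/2) *\<^sub>R (u s - drift a \<theta> (x s))) (\<lambda>_. \<theta>)"
proof -
  have "((\<lambda>s. (1/2) *\<^sub>R (u s - drift a \<theta> (x s))) has_vector_derivative (1/2) *\<^sub>R drift a \<theta> (u s))
      (at s within {0..1})" if s: "s \<in> {0..1}" for s
    by (rule has_vector_derivative_eq_rhs[OF
          bounded_linear.has_vector_derivative[OF bounded_linear_scaleR_right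
            has_vector_derivative_diff[OF u[OF s]
              bounded_linear.has_vector_derivative[OF bounded_linear_drift x[OF s]]]]])
       (simp add: scaleR_2)
  with x z show ?thesis by (simp add: bicharacteristic_iff)
qed

section \<open>Explicit solutions starting at the origin\<close>

lemma blockM_nth_inner_drift_nth:
  "((a m l *\<^sub>R quatM m) *v y) \<bullet> (imag_quat (\<lambda>k. a k l * \<theta> $ k) *v y)
    = \<theta> $ m * ((a m l)\<^sup>2 * (norm y)\<^sup>2)"
  by (simp add: quatM_eq_imag_quat scaleR_matrix_vector_assoc[symmetric] imag_quat_inner
      power2_norm_eq_inner power2_eq_square[of "a m l"]
      if_distrib[of "\<lambda>c. c * _"] cong: if_cong)

lemma blockM_inner_drift:
  "blockM a m x \<bullet> drift a \<theta> x = \<theta> $ m * (\<Sum>l\<in>UNIV. (a m l)\<^sup>2 * (norm (x $ l))\<^sup>2)"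
  unfolding inner_blocks[of "blockM a m x"]
  by (simp add: blockM_def drift_nth blockM_nth_inner_drift_nth sum_distrib_left)

text \<open>
  The hypothesis fixes the frequencies only of the blocks that move initially. The other blocks
  stay at rest, and the formulas hold there as well since both of their terms vanish.
\<close>

lemma rotation_from_origin:
  fixes a :: "3 \<Rightarrow> 'n::finite \<Rightarrow> real" and w :: "'n \<Rightarrow> real"
  assumes x: "\<And>s. s \<in> {0..1} \<Longrightarrow> (x has_vector_derivative u s) (at s within {0..1})"
    and u: "\<And>s. s \<in> {0..1} \<Longrightarrow> (u has_vector_derivative 2 *\<^sub>R drift a \<theta> (u s)) (at s within {0..1})"
    and z: "\<And>s. s \<in> {0..1} \<Longrightarrow>
      (z has_vector_derivative (\<chi> m. 1/2 * (blockM a m (x s) \<bullet> u s))) (at s within {0..1})"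
    and init: "x 0 = 0" "z 0 = 0"
    and w: "\<And>l. w l \<noteq> 0" "\<And>l. u 0 $ l \<noteq> 0 \<Longrightarrow> theta_abs a \<theta> l = w l"
    and s: "s \<in> {0..1}"
  shows "x s $ l = (sin (2 * w l * s) / (2 * w l)) *\<^sub>R (u 0 $ l)
      + ((1 - cos (2 * w l * s)) / (2 * (w l)\<^sup>2)) *\<^sub>R (drift a \<theta> (u 0) $ l)"
    and "z s $ m = \<theta> $ m / 4 * (\<Sum>l\<in>UNIV. (a m l)\<^sup>2 * (norm (u 0 $ l))\<^sup>2 / (w l)\<^sup>2 *
      (s - sin (2 * w l * s) / (2 * w l)))"
proof -
  define v where "v = u 0"
  define A where "A = (\<lambda>l. (*v) (imag_quat (\<lambda>m. a m l * \<theta> $ m)))"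
  define U where "U = (\<lambda>l s. cos (2 * w l * s) *\<^sub>R (v $ l) + (sin (2 * w l * s) / w l) *\<^sub>R A l (v $ l))"
  define X where "X = (\<lambda>l s. (sin (2 * w l * s) / (2 * w l)) *\<^sub>R (v $ l)
      + ((1 - cos (2 * w l * s)) / (2 * (w l)\<^sup>2)) *\<^sub>R A l (v $ l))"
  note nth = bounded_linear.has_vector_derivative[OF bounded_linear_vec_nth]
  have A: "bounded_linear (A l)" "y \<bullet> A l y = 0" for l y
    using imag_quat_skew[of "\<lambda>m. a m l * \<theta> $ m" y y] by (auto simp: A_def inner_commute)
  \<comment> \<open>A block at rest has \<open>v $ l = 0\<close>, and then both sides vanish.\<close>
  have AA: "A l (A l (v $ l)) = - ((w l)\<^sup>2) *\<^sub>R (v $ l)" for l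
    using w(2)[of l] by (cases "v $ l = 0")
      (auto simp: A_def v_def imag_quat_square theta_abs_square[symmetric])
  have u_eq: "u t $ l = U l t" if "t \<in> {0..1}" for t l
  proof -
    have "norm (u t $ l - U l t) = norm (u 0 $ l - U l 0)"
    proof (rule skew_flow_norm_constant[where A = "A l" and k = 2, OF _ A(2) that])
      fix t :: real assume t: "t \<in> {0..1}"
      show "((\<lambda>t. u t $ l - U l t) has_vector_derivative 2 *\<^sub>R A l (u t $ l - U l t))
          (at t within {0..1})"
        using has_vector_derivative_diff[OF nth[OF u[OF t], of l]
            rotation_flow_derivative[OF A(1) AA w(1), of l t "{0..1}"]]
        by (simp add: U_def drift_nth A_def matrix_vector_mult_diff_distrib scaleR_diff_right)
    qed
    then show ?thesis by (simp add: U_def v_def)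
  qed
  have x_eq: "x t $ l = X l t" if "t \<in> {0..1}" for t l
  proof -
    have "x t $ l - X l t = x 0 $ l - X l 0"
    proof (rule vector_derivative_zero_imp_constant[OF _ that])
      fix t :: real assume t: "t \<in> {0..1}"
      show "((\<lambda>t. x t $ l - X l t) has_vector_derivative 0) (at t within {0..1})"
        using has_vector_derivative_diff[OF nth[OF x[OF t], of l]
            rotation_flow_integral[OF w(1), of l "v $ l" "A l (v $ l)" t "{0..1}"]]
        by (simp add: X_def u_eq[OF t] U_def)
    qed
    then show ?thesis by (simp add: X_def init)
  qed
  show "x s $ l = (sin (2 * w l * s) / (2 * w l)) *\<^sub>R (u 0 $ l)
      + ((1 - cos (2 * w l * s)) / (2 * (w l)\<^sup>2)) *\<^sub>R (drift a \<theta> (u 0) $ l)"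
    using x_eq[OF s] by (simp add: X_def v_def A_def drift_nth)
  define Z where "Z = (\<lambda>s. \<theta> $ m / 4 * (\<Sum>l\<in>UNIV. (a m l)\<^sup>2 * (norm (v $ l))\<^sup>2 / (w l)\<^sup>2 *
      (s - sin (2 * w l * s) / (2 * w l))))"
  have area: "blockM a m (x t) \<bullet> u t = (\<Sum>l\<in>UNIV.
      (1 - cos (2 * w l * t)) / (2 * (w l)\<^sup>2) * (\<theta> $ m * ((a m l)\<^sup>2 * (norm (v $ l))\<^sup>2)))"
    if t: "t \<in> {0..1}" for t
  proof -
    have "((a m l *\<^sub>R quatM m) *v X l t) \<bullet> U l t = (1 - cos (2 * w l * t)) / (2 * (w l)\<^sup>2) *
        (((a m l *\<^sub>R quatM m) *v (v $ l)) \<bullet> A l (v $ l))" for l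
      unfolding X_def U_def
      by (rule rotation_flow_area[OF matrix_vector_mul_bounded_linear _ w(1)])
         (simp_all add: scaleR_matrix_vector_assoc[symmetric] quatM_eq_imag_quat imag_quat_skew)
    then show ?thesis
      unfolding inner_blocks[of "blockM a m (x t)"]
      by (simp add: blockM_def x_eq[OF t] u_eq[OF t] A_def blockM_nth_inner_drift_nth)
  qed
  have "z s $ m - Z s = z 0 $ m - Z 0"
  proof (rule vector_derivative_zero_imp_constant[OF _ s])
    fix t :: real assume t: "t \<in> {0..1}"
    have "((\<lambda>s. s - sin (2 * w l * s) / (2 * w l)) has_real_derivative 1 - cos (2 * w l * t))
        (at t within {0..1})" for l
      using w(1)[of l] by (auto intro!: derivative_eq_intros)
    then have "(Z has_real_derivative \<theta> $ m / 4 * (\<Sum>l\<in>UNIV. (a m l)\<^sup>2 * (norm (v $ l))\<^sup>2 / (w l)\<^sup>2 *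
      (1 - cos (2 * w l * t)))) (at t within {0..1})"
      unfolding Z_def by (intro DERIV_cmult DERIV_sum)
    also have "\<theta> $ m / 4 * (\<Sum>l\<in>UNIV. (a m l)\<^sup>2 * (norm (v $ l))\<^sup>2 / (w l)\<^sup>2 *
      (1 - cos (2 * w l * t))) = 1/2 * (blockM a m (x t) \<bullet> u t)"
      by (simp add: area[OF t] sum_distrib_left mult_ac)
    finally have "(Z has_vector_derivative 1/2 * (blockM a m (x t) \<bullet> u t)) (at t within {0..1})"
      by (simp add: has_real_derivative_iff_has_vector_derivative)
    from has_vector_derivative_diff[OF nth[OF z[OF t], of m] this]
    show "((\<lambda>t. z t $ m - Z t) has_vector_derivative 0) (at t within {0..1})" by simp
  qed
  then show "z s $ m = \<theta> $ m / 4 * (\<Sum>l\<in>UNIV. (a m l)\<^sup>2 * (norm (u 0 $ l))\<^sup>2 / (w l)\<^sup>2 *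
      (s - sin (2 * w l * s) / (2 * w l)))"
    by (simp add: Z_def init v_def)
qed

lemma velocity_eq:
  assumes "\<And>s. s \<in> {0..1} \<Longrightarrow> ((\<lambda>s. fst (c s)) has_vector_derivative u s) (at s within {0..1})"
    and "s \<in> {0..1}"
  shows "velocity c s = u s"
  unfolding velocity_def using assms by (intro vector_derivative_within_closed_interval) auto

lemma geodesic_length_eq_initial_speed:
  assumes x: "\<And>s. s \<in> {0..1} \<Longrightarrow> ((\<lambda>s. fst (c s)) has_vector_derivative u s) (at s within {0..1})"
    and u: "\<And>s. s \<in> {0..1} \<Longrightarrow> (u has_vector_derivative 2 *\<^sub>R drift a \<theta> (u s)) (at s within {0..1})"
  shows "geodesic_length c = norm (u 0)"
proof -
  have skew: "y \<bullet> drift a \<theta> y = 0" for y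
    using drift_skew[of a \<theta> y y] by (simp add: inner_commute)
  have "integral {0..1} (\<lambda>s. norm (velocity c s)) = integral {0..1} (\<lambda>s::real. norm (u 0))"
  proof (rule Henstock_Kurzweil_Integration.integral_cong)
    fix s :: real assume s: "s \<in> {0..1}"
    show "norm (velocity c s) = norm (u 0)"
      using skew_flow_norm_constant[OF u skew s] velocity_eq[OF x s] by simp
  qed
  then show ?thesis by (simp add: geodesic_length_def)
qed

section \<open>Infinitely many geodesics\<close>

text \<open>
  Let the initial velocity \<open>v\<close> have length \<open>r\<close> and lie in the block \<open>l\<close>, and put \<open>w = \<pi> k\<close>. The
  endpoint is \<open>(0, z)\<close> if \<open>\<theta>\<^sub>m = 4 w\<^sup>2 z\<^sub>m / (a\<^sub>m\<^sub>l\<^sup>2 r\<^sup>2)\<close>, while the frequency condition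
  \<open>|\<theta>|\<^sub>l = w\<close> becomes \<open>16 w\<^sup>4 K / r\<^sup>4 = w\<^sup>2\<close> with \<open>K = \<Sum>\<^sub>m z\<^sub>m\<^sup>2 / a\<^sub>m\<^sub>l\<^sup>2\<close>; it is solved by
  \<open>r\<^sup>2 = 4 w K\<^sup>1\<^sup>/\<^sup>2\<close>.
\<close>

lemma single_block_geodesic:
  fixes a :: "3 \<Rightarrow> 'n::finite \<Rightarrow> real" and z :: "real^3" and k :: nat
  assumes a: "\<And>m. 0 < a m l" and "z \<noteq> 0" and "0 < k"
  shows "\<exists>c\<in>extensional {0..1}. geodesic a (0, 0) (0, z) c \<and>
    (geodesic_length c)\<^sup>2 = 4 * (pi * real k) * sqrt (\<Sum>m\<in>UNIV. (z $ m)\<^sup>2 / (a m l)\<^sup>2)"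
proof -
  define w where "w = pi * real k"
  define K where "K = (\<Sum>m\<in>UNIV. (z $ m)\<^sup>2 / (a m l)\<^sup>2)"
  define r where "r = sqrt (4 * w * sqrt K)"
  define \<theta> :: "real^3" where "\<theta> = (\<chi> m. 4 * w\<^sup>2 * z $ m / ((a m l)\<^sup>2 * r\<^sup>2))"
  define v :: "real^4^'n" where "v = axis l (axis 1 r)"
  define x where "x = (\<lambda>s. (sin (2 * w * s) / (2 * w)) *\<^sub>R v
      + ((1 - cos (2 * w * s)) / (2 * w\<^sup>2)) *\<^sub>R drift a \<theta> v)"
  define u where "u = (\<lambda>s. cos (2 * w * s) *\<^sub>R v + (sin (2 * w * s) / w) *\<^sub>R drift a \<theta> v)"
  define c where "c = restrict (\<lambda>s. (x s, (s - sin (2 * w * s) / (2 * w)) *\<^sub>R z)) {0..1}"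
  have w: "w > 0" "sin (2 * w) = 0" "cos (2 * w) = 1"
    using \<open>0 < k\<close> sin_npi[of "2 * k"] cos_npi[of "2 * k"] by (auto simp: w_def mult_ac)
  have "K > 0"
  proof -
    obtain m where "z $ m \<noteq> 0" using \<open>z \<noteq> 0\<close> by (auto simp: vec_eq_iff)
    then have "0 < (z $ m)\<^sup>2 / (a m l)\<^sup>2" using a[of m] by simp
    then show ?thesis unfolding K_def by (intro sum_pos2[where i = m]) auto
  qed
  have r2: "r\<^sup>2 = 4 * w * sqrt K" using w \<open>K > 0\<close> by (simp add: r_def)
  have r4: "r\<^sup>2 * r\<^sup>2 = 16 * w\<^sup>2 * K" unfolding r2 using \<open>K > 0\<close> by (simp add: power2_eq_square)
  have "r\<^sup>2 > 0" using r2 w \<open>K > 0\<close> by simp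
  have norm_v: "norm (v $ i) = (if i = l then \<bar>r\<bar> else 0)" for i
    by (simp add: v_def axis_def norm_eq_sqrt_inner inner_vec_def sum_4)
  have "(\<Sum>m\<in>UNIV. (a m l * \<theta> $ m)\<^sup>2) = 16 * w ^ 4 / (r\<^sup>2 * r\<^sup>2) * K"
    unfolding K_def sum_distrib_left
  proof (rule sum.cong)
    fix m show "(a m l * \<theta> $ m)\<^sup>2 = 16 * w ^ 4 / (r\<^sup>2 * r\<^sup>2) * ((z $ m)\<^sup>2 / (a m l)\<^sup>2)"
      using a[of m] \<open>r\<^sup>2 > 0\<close> by (simp add: \<theta>_def power2_eq_square power4_eq_xxxx mult_ac)
  qed simp
  also have "\<dots> = w\<^sup>2" unfolding r4 using w \<open>K > 0\<close>
    by (simp add: power2_eq_square power4_eq_xxxx)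
  finally have freq: "(\<Sum>m\<in>UNIV. (a m l * \<theta> $ m)\<^sup>2) = w\<^sup>2" .
  have "drift a \<theta> (drift a \<theta> v) $ i = (- (w\<^sup>2) *\<^sub>R v) $ i" for i
    using norm_v[of i] by (cases "i = l") (simp_all add: drift_nth imag_quat_square freq)
  then have square: "drift a \<theta> (drift a \<theta> v) = - (w\<^sup>2) *\<^sub>R v" by (simp add: vec_eq_iff)
  have area: "blockM a m v \<bullet> drift a \<theta> v = 4 * w\<^sup>2 * z $ m" for m
  proof -
    have "(\<Sum>i\<in>UNIV. (a m i)\<^sup>2 * (norm (v $ i))\<^sup>2) = (a m l)\<^sup>2 * r\<^sup>2"
      by (simp add: norm_v if_distrib[of "\<lambda>y. _ * y\<^sup>2"] cong: if_cong)
    then show ?thesis using a[of m] \<open>r\<^sup>2 > 0\<close> by (simp add: blockM_inner_drift \<theta>_def)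
  qed
  have x': "((\<lambda>s. fst (c s)) has_vector_derivative u s) (at s within {0..1})" if "s \<in> {0..1}" for s
    by (rule has_vector_derivative_transform[OF that, of _ x])
       (use w in \<open>auto simp: c_def x_def u_def intro: rotation_flow_integral\<close>)
  have u': "(u has_vector_derivative 2 *\<^sub>R drift a \<theta> (u s)) (at s within {0..1})" for s
    unfolding u_def
    by (rule rotation_flow_derivative[OF bounded_linear_drift square]) (use w in simp)
  have z': "((\<lambda>s. snd (c s)) has_vector_derivative
      (\<chi> m. 1/2 * (blockM a m (fst (c s)) \<bullet> u s))) (at s within {0..1})" if s: "s \<in> {0..1}" for s
  proof (rule has_vector_derivative_transform[OF s])
    have "((\<lambda>s. s - sin (2 * w * s) / (2 * w)) has_real_derivative 1 - cos (2 * w * s))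
        (at s within {0..1})"
      using w by (auto intro!: derivative_eq_intros)
    from has_vector_derivative_scaleR[OF this has_vector_derivative_const]
    have "((\<lambda>s. (s - sin (2 * w * s) / (2 * w)) *\<^sub>R z) has_vector_derivative
        (1 - cos (2 * w * s)) *\<^sub>R z) (at s within {0..1})" by simp
    also have "(1 - cos (2 * w * s)) *\<^sub>R z = (\<chi> m. 1/2 * (blockM a m (fst (c s)) \<bullet> u s))"
      using s w rotation_flow_area[OF bounded_linear_blockM blockM_skew, of w a _ s v "drift a \<theta> v"]
      by (simp add: c_def x_def u_def area vec_eq_iff)
    finally show "((\<lambda>s. (s - sin (2 * w * s) / (2 * w)) *\<^sub>R z) has_vector_derivative
        (\<chi> m. 1/2 * (blockM a m (fst (c s)) \<bullet> u s))) (at s within {0..1})" .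
  qed (simp add: c_def)
  have "geodesic a (0, 0) (0, z) c"
    unfolding geodesic_def lifts_to_def
    using rotation_imp_bicharacteristic[OF x' u' z'] w by (auto simp: c_def x_def)
  moreover have "geodesic_length c = norm v"
    using geodesic_length_eq_initial_speed[OF x' u'] by (simp add: u_def)
  moreover have "(norm v)\<^sup>2 = r\<^sup>2"
    by (simp add: power2_norm_eq_inner v_def inner_axis_axis)
       (simp add: power2_eq_square)
  moreover have "c \<in> extensional {0..1}" by (simp add: c_def)
  ultimately show ?thesis unfolding r2 w_def K_def by (intro bexI[of _ c] conjI) simp_all
qed

lemma infinite_geodesics:
  fixes a :: "3 \<Rightarrow> 'n::finite \<Rightarrow> real" and z :: "real^3"
  assumes "\<And>m l. 0 < a m l" and "z \<noteq> 0"
  shows "infinite {c \<in> extensional {0..1}. geodesic a (0, 0) (0, z) c}"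
proof -
  \<comment> \<open>The index \<open>undefined\<close> serves as an arbitrary choice of the moving block.\<close>
  define K where "K = (\<Sum>m\<in>UNIV. (z $ m)\<^sup>2 / (a m undefined)\<^sup>2)"
  have "\<exists>c. c \<in> extensional {0..1} \<and> geodesic a (0, 0) (0, z) c \<and>
      (geodesic_length c)\<^sup>2 = 4 * (pi * real (Suc k)) * sqrt K" for k
    using single_block_geodesic[of a undefined z "Suc k"] assms unfolding K_def by blast
  then obtain c where c: "\<And>k. c k \<in> extensional {0..1}" "\<And>k. geodesic a (0, 0) (0, z) (c k)"
    and len: "\<And>k. (geodesic_length (c k))\<^sup>2 = 4 * (pi * real (Suc k)) * sqrt K"
    by metis
  have "K \<noteq> 0"
  proof
    assume "K = 0"
    then have "(z $ m)\<^sup>2 / (a m undefined)\<^sup>2 = 0" for m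
      unfolding K_def by (subst (asm) sum_nonneg_eq_0_iff) auto
    then have "z $ m = 0" for m using assms(1)[of m undefined] by (auto dest: meta_spec[of _ m])
    then show False using \<open>z \<noteq> 0\<close> by (simp add: vec_eq_iff)
  qed
  have "inj c"
  proof (rule injI)
    fix j k assume "c j = c k"
    then have "4 * (pi * real (Suc j)) * sqrt K = 4 * (pi * real (Suc k)) * sqrt K"
      using len by metis
    then show "j = k" using \<open>K \<noteq> 0\<close> by simp
  qed
  then have "infinite (range c)" by (rule range_inj_infinite)
  then show ?thesis by (rule contrapos_nn) (rule finite_subset[rotated], use c in auto)
qed

section \<open>Geodesics of a given multi-index\<close>

text \<open>
  At \<open>s = 1\<close> the sines vanish, and the \<open>z\<close>-component of the explicit solution reduces to
  \<open>z\<^sub>m = \<theta>\<^sub>m D\<^sub>m / 4\<close>. Solving for \<open>\<theta>\<close> turns \<open>\<Omega>\<close> into \<open>4[\<^bold>Z]\<^sub>l\<close> on the block \<open>l\<close>. For the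
  length one inserts \<open>|\<theta>|\<^sub>l\<^sup>2 / (\<pi> n\<^sub>l)\<^sup>2 = 1\<close>, valid on the moving blocks, into \<open>\<Sum>\<^sub>l |v\<^sub>l|\<^sup>2\<close> and exchanges the sums.
\<close>

lemma corresponding_geodesic:
  fixes a :: "3 \<Rightarrow> 'n::finite \<Rightarrow> real" and z :: "real^3" and n :: "'n \<Rightarrow> nat"
  assumes a: "\<And>m l. 0 < a m l" and "z \<noteq> 0" and n: "\<And>l. 0 < n l"
    and c: "geodesic a (0, 0) (0, z) c" "corresponds_to a c n"
  defines "v \<equiv> velocity c 0" and "w \<equiv> \<lambda>l. pi * real (n l)"
  defines "D \<equiv> Dcoef a n v"
  shows "D m \<noteq> 0"
    and "s \<in> {0..1} \<Longrightarrow> fst (c s) $ l =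
      (2 * ((1 - cos (2 * w l * s)) / (w l)\<^sup>2)) *\<^sub>R (Zmat a n z v l *v (v $ l))
      + (sin (2 * w l * s) / (2 * w l)) *\<^sub>R (v $ l)"
    and "s \<in> {0..1} \<Longrightarrow> snd (c s) $ m = z $ m / D m *
      (\<Sum>l\<in>UNIV. (a m l)\<^sup>2 * (norm (v $ l))\<^sup>2 / (w l)\<^sup>2 * (s - sin (2 * w l * s) / (2 * w l)))"
    and "(geodesic_length c)\<^sup>2 = 16 * (\<Sum>m\<in>UNIV. (z $ m)\<^sup>2 / D m)"
proof -
  obtain \<xi> \<theta>' where lift: "bicharacteristic a (\<lambda>s. fst (c s)) (\<lambda>s. snd (c s)) \<xi> \<theta>'"
    and "\<And>l. v $ l \<noteq> 0 \<Longrightarrow> theta_abs a (\<theta>' 0) l = w l"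
    using c(2) unfolding corresponds_to_def lifts_to_def v_def w_def by fastforce
  moreover obtain \<theta> u where "\<And>s. s \<in> {0..1} \<Longrightarrow> \<theta>' s = \<theta>"
    and x: "\<And>s. s \<in> {0..1} \<Longrightarrow> ((\<lambda>s. fst (c s)) has_vector_derivative u s) (at s within {0..1})"
    and u: "\<And>s. s \<in> {0..1} \<Longrightarrow> (u has_vector_derivative 2 *\<^sub>R drift a \<theta> (u s)) (at s within {0..1})"
    and zd: "\<And>s. s \<in> {0..1} \<Longrightarrow> ((\<lambda>s. snd (c s)) has_vector_derivative
      (\<chi> m. 1/2 * (blockM a m (fst (c s)) \<bullet> u s))) (at s within {0..1})"
    by (rule bicharacteristic_imp_rotation[OF lift]) blast
  ultimately have freq: "theta_abs a \<theta> l = w l" if "v $ l \<noteq> 0" for l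
    using that by force
  have u0: "u 0 = v" using velocity_eq[OF x, of 0] by (simp add: v_def)
  have w: "w l \<noteq> 0" "sin (2 * w l) = 0" for l
    using n[of l] sin_npi[of "2 * n l"] by (auto simp: w_def mult_ac)
  have ends: "c 0 = (0, 0)" "c 1 = (0, z)" using c(1) by (auto simp: geodesic_def)
  note formulas = rotation_from_origin[OF x u zd _ _ w(1) freq, unfolded u0]
  have D_def': "D m = (\<Sum>l\<in>UNIV. (a m l)\<^sup>2 * (norm (v $ l))\<^sup>2 / (w l)\<^sup>2)" for m
    by (simp add: D_def Dcoef_def w_def)
  have z_eq: "z $ m = \<theta> $ m / 4 * D m" for m
    using formulas(2)[of 1 m] by (simp add: ends w D_def')
  obtain l\<^sub>0 where l\<^sub>0: "v $ l\<^sub>0 \<noteq> 0"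
  proof (rule ccontr)
    assume "\<not> thesis"
    with that have "v $ l = 0" for l by blast
    then have "D m = 0" for m by (simp add: D_def')
    then show False using z_eq \<open>z \<noteq> 0\<close> by (simp add: vec_eq_iff)
  qed
  have D: "D m \<noteq> 0" for m
  proof -
    have "0 < (a m l\<^sub>0)\<^sup>2 * (norm (v $ l\<^sub>0))\<^sup>2 / (w l\<^sub>0)\<^sup>2" using a[of m l\<^sub>0] l\<^sub>0 w(1)[of l\<^sub>0] by simp
    then have "0 < D m" unfolding D_def' by (intro sum_pos2[where i = l\<^sub>0]) auto
    then show ?thesis by simp
  qed
  then show "D m \<noteq> 0" .
  have \<theta>: "\<theta> $ m = 4 * (z $ m / D m)" for m using D[of m] z_eq[of m] by (simp add: field_simps)
  have Z: "drift a \<theta> v $ l = 4 *\<^sub>R (Zmat a n z v l *v (v $ l))"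
    by (simp add: drift_nth \<theta> imag_quat_def Zmat_def D_def[symmetric] scaleR_matrix_vector_assoc
        scaleR_sum_right mult_ac)
  show "fst (c s) $ l =
      (2 * ((1 - cos (2 * w l * s)) / (w l)\<^sup>2)) *\<^sub>R (Zmat a n z v l *v (v $ l))
      + (sin (2 * w l * s) / (2 * w l)) *\<^sub>R (v $ l)" if "s \<in> {0..1}"
    using formulas(1)[of s l] that w(1)[of l] by (simp add: ends Z) (simp add: field_simps)
  show "snd (c s) $ m = z $ m / D m *
      (\<Sum>l\<in>UNIV. (a m l)\<^sup>2 * (norm (v $ l))\<^sup>2 / (w l)\<^sup>2 * (s - sin (2 * w l * s) / (2 * w l)))"
    if "s \<in> {0..1}"
    using formulas(2)[of s m] that by (simp add: ends \<theta>)
  have "(geodesic_length c)\<^sup>2 = (\<Sum>l\<in>UNIV. (norm (v $ l))\<^sup>2)"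
    using geodesic_length_eq_initial_speed[OF x u] by (simp add: u0 power2_norm_eq_inner inner_blocks)
  also have "\<dots> = (\<Sum>l\<in>UNIV. (theta_abs a \<theta> l)\<^sup>2 * (norm (v $ l))\<^sup>2 / (w l)\<^sup>2)"
  proof (rule sum.cong)
    fix l show "(norm (v $ l))\<^sup>2 = (theta_abs a \<theta> l)\<^sup>2 * (norm (v $ l))\<^sup>2 / (w l)\<^sup>2"
      using freq[of l] w(1)[of l] by (cases "v $ l = 0") simp_all
  qed simp
  also have "\<dots> = (\<Sum>m\<in>UNIV. (\<theta> $ m)\<^sup>2 * D m)"
    unfolding theta_abs_square D_def' sum_distrib_left sum_distrib_right sum_divide_distrib
    by (subst sum.swap) (simp add: power_mult_distrib mult_ac)
  also have "\<dots> = 16 * (\<Sum>m\<in>UNIV. (z $ m)\<^sup>2 / D m)"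
    using D by (simp add: \<theta> sum_distrib_left power2_eq_square)
  finally show "(geodesic_length c)\<^sup>2 = 16 * (\<Sum>m\<in>UNIV. (z $ m)\<^sup>2 / D m)" .
qed

theorem theorem5p2:
  fixes a :: "3 \<Rightarrow> 'n::finite \<Rightarrow> real" and z :: "real^3"
  assumes "\<And>m l. 0 < a m l"
    and "z \<noteq> 0"
  shows "infinite {c \<in> extensional {0..1}. geodesic a (0, 0) (0, z) c} \<and>
    (\<forall>n :: 'n \<Rightarrow> nat. (\<forall>l. 0 < n l) \<longrightarrow>
      (\<forall>c. geodesic a (0, 0) (0, z) c \<and> corresponds_to a c n \<longrightarrow>
        (let v = velocity c 0; D = Dcoef a n v in
          (\<forall>m. D m \<noteq> 0) \<and>
          (\<forall>s\<in>{0..1}. \<forall>l. fst (c s) $ l =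
             (2 * ((1 - cos (2 * s * pi * real (n l))) / (pi * real (n l))^2))
                 *\<^sub>R (Zmat a n z v l *v (v $ l))
             + (sin (2 * s * pi * real (n l)) / (2 * pi * real (n l))) *\<^sub>R (v $ l)) \<and>
          (\<forall>s\<in>{0..1}. \<forall>m. snd (c s) $ m =
             z $ m / D m *
               (\<Sum>l\<in>UNIV. (a m l)^2 * (norm (v $ l))^2 / (pi * real (n l))^2 *
                  (s - sin (2 * s * pi * real (n l)) / (2 * pi * real (n l))))) \<and>
          (geodesic_length c)^2 = 16 * (\<Sum>m\<in>UNIV. (z $ m)^2 / D m))))"
proof -
  have arg: "2 * s * pi * real (n l) = 2 * (pi * real (n l)) * s"
    "2 * pi * real (n l) = 2 * (pi * real (n l))" for s and n :: "'n \<Rightarrow> nat" and l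
    by simp_all
  show ?thesis
    unfolding Let_def arg
    by (intro conjI infinite_geodesics[OF assms] allI impI ballI; elim conjE;
        intro corresponding_geodesic[OF assms]; blast)
qed

end
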